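(* Consider a network with node set $\mathcal V=\{o,d\}$ and $|\mathcal E|=N$ parallel links from $o$ to $d$, with unit throughput. Assume the delay functions are $\tau_e(\theta_e,f_e)=f_e/\alpha_e+\theta_e$ with $\alpha_e>0$ for $e\in\mathcal E$, and that the system-optimum flow satisfies $f^*_e(\theta)>0$ for every $e\in\mathcal E$ and every $\theta\in\operatorname{supp}(\Theta)$. Let $\Delta_{ij}=\mathbb E[\Theta_i-\Theta_j]$ and $K_{ij}=\mathbb E[\Theta_i\Theta_j]-\mathbb E[\Theta_i]\mathbb E[\Theta_j]$ for $i,j\in\mathcal E$, and suppose that: (i) $\Delta=\mathbf 0$; (ii) $K$ is diagonal. Then the direct signaling rule $\pi^*=f^*$ is an optimal rule and $C(f^{\pi^*})=C(f^* )$.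
   Context: A unit mass of users travels from $o$ to $d$; each link is a path. Let $\mathcal F=\{x\in\mathbb R_+^{\mathcal E}:\sum_ex_e=1\}$. The network state $\Theta$ is a random vector in $\mathbb R_+^{\mathcal E}$ with law denoted $\mathbb P$, whose entries have finite first and second moments; $\operatorname{supp}(\Theta)$ is the support of its law. The cost of a network flow $f:\mathbb R_+^{\mathcal E}\to\mathcal F$ is $C(f)=\mathbb E\big[\sum_ef_e(\Theta)\tau_e(\Theta_e,f_e(\Theta))\big]$. The system-optimum flow is $f^*(\theta)=\arg\min_{x\in\mathcal F}\sum_ex_e\tau_e(\theta_e,x_e)$ (unique). For a finite message set $\mathcal M$, a signaling rule is a measurable map $\pi:\mathbb R_+^{\mathcal E}\to\mathbb R_+^{\mathcal M}$ with $\sum_m\pi_m(\theta)=1$ for all $\theta$ ($\pi_m(\theta)$ is the fraction of users receiving message $m$ when $\Theta=\theta$). For $y\in\mathbb R_+^{\mathcal E\times\mathcal M}$ with $\sum_{e}y_{em}=1$ for every $m$, let $f^{\pi,y}(\theta)=y\pi(\theta)$. $f^{\pi,y}$ is a Bayesian Wardrop equilibrium (BWE) for $\pi$ if, whenever $y_{im}>0$, $\int\big(\tau_i(\theta_i,f_i^{\pi,y}(\theta))-\tau_j(\theta_j,f_j^{\pi,y}(\theta))\big)\pi_m(\theta)\,d\mathbb P(\theta)\le0$ for every $j\in\mathcal E$. Every rule $\pi$ has a BWE, unique up to $\mathbb P$-null sets of $\theta$, denoted $f^\pi$; $C(f^\pi)$ is the cost of the rule. A rule is optimal if it minimizes $C(f^\pi)$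 over all finite message sets $\mathcal M$ and all rules with message set $\mathcal M$. $f^*$ is regarded as a signaling rule with message set $\mathcal M=\mathcal E$ (messages are link recommendations). *)

theory Defs
  imports "HOL-Probability.Probability"
begin

text \<open>
  The finite type \<open>'e\<close> is the set of parallel links. A state \<open>\<theta>\<close> and a flow \<open>x\<close> are vectors in
  \<open>real ^ 'e\<close>, and \<open>\<tau> e t x\<close> is the delay of link \<open>e\<close> when its state is \<open>t\<close> and its flow is \<open>x\<close>.
\<close>

definition orthant :: "(real ^ 'e::finite) set" where
  "orthant = {\<theta>. \<forall>e. 0 \<le> \<theta> $ e}"

definition orthant_borel :: "(real ^ 'e::finite) measure" where
  "orthant_borel = restrict_space borel orthant"

definition flows :: "(real ^ 'e::finite) set" where
  "flows = {x \<in> orthant. (\<Sum>e\<in>UNIV. x $ e) = 1}"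

definition total_delay ::
  "('e \<Rightarrow> real \<Rightarrow> real \<Rightarrow> real) \<Rightarrow> real ^ 'e \<Rightarrow> real ^ 'e::finite \<Rightarrow> real" where
  "total_delay \<tau> \<theta> x = (\<Sum>e\<in>UNIV. x $ e * \<tau> e (\<theta> $ e) (x $ e))"

text \<open>Throughout, \<open>P\<close> is the law of the network state, a measure on the nonnegative orthant.\<close>

definition flow_cost ::
  "('e \<Rightarrow> real \<Rightarrow> real \<Rightarrow> real) \<Rightarrow> (real ^ 'e::finite) measure \<Rightarrow> (real ^ 'e \<Rightarrow> real ^ 'e) \<Rightarrow> real" where
  "flow_cost \<tau> P f = (\<integral>\<theta>. total_delay \<tau> \<theta> (f \<theta>) \<partial>P)"

definition law_support :: "(real ^ 'e::finite) measure \<Rightarrow> (real ^ 'e) set" where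
  "law_support P =
     {\<theta> \<in> space P. \<forall>U. open U \<and> \<theta> \<in> U \<longrightarrow> 0 < emeasure P (U \<inter> space P)}"

definition system_optimum ::
  "('e \<Rightarrow> real \<Rightarrow> real \<Rightarrow> real) \<Rightarrow> real ^ 'e::finite \<Rightarrow> real ^ 'e" where
  "system_optimum \<tau> \<theta> = (ARG_MIN (total_delay \<tau> \<theta>) x. x \<in> flows)"

text \<open>A message set is a finite set \<open>M :: 'm set\<close>; rules are only constrained on states in the
  orthant and on messages in \<open>M\<close>.\<close>

definition signaling_rule :: "'m set \<Rightarrow> (real ^ 'e::finite \<Rightarrow> 'm \<Rightarrow> real) \<Rightarrow> bool" where
  "signaling_rule M \<pi> \<longleftrightarrow>
     finite M \<and>
     (\<forall>m\<in>M. (\<lambda>\<theta>. \<pi> \<theta> m) \<in> borel_measurable orthant_borel) \<and>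
     (\<forall>\<theta>\<in>orthant. (\<forall>m\<in>M. 0 \<le> \<pi> \<theta> m) \<and> (\<Sum>m\<in>M. \<pi> \<theta> m) = 1)"

definition response :: "'m set \<Rightarrow> ('e::finite \<Rightarrow> 'm \<Rightarrow> real) \<Rightarrow> bool" where
  "response M y \<longleftrightarrow> (\<forall>m\<in>M. (\<forall>e. 0 \<le> y e m) \<and> (\<Sum>e\<in>UNIV. y e m) = 1)"

definition induced_flow ::
  "'m set \<Rightarrow> (real ^ 'e \<Rightarrow> 'm \<Rightarrow> real) \<Rightarrow> ('e \<Rightarrow> 'm \<Rightarrow> real) \<Rightarrow> real ^ 'e::finite \<Rightarrow> real ^ 'e" where
  "induced_flow M \<pi> y \<theta> = (\<chi> e. \<Sum>m\<in>M. y e m * \<pi> \<theta> m)"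

definition is_BWE ::
  "('e \<Rightarrow> real \<Rightarrow> real \<Rightarrow> real) \<Rightarrow> (real ^ 'e::finite) measure \<Rightarrow> 'm set \<Rightarrow>
     (real ^ 'e \<Rightarrow> 'm \<Rightarrow> real) \<Rightarrow> (real ^ 'e \<Rightarrow> real ^ 'e) \<Rightarrow> bool" where
  "is_BWE \<tau> P M \<pi> f \<longleftrightarrow>
     (\<exists>y. response M y \<and> f = induced_flow M \<pi> y \<and>
        (\<forall>m\<in>M. \<forall>i. y i m > 0 \<longrightarrow>
           (\<forall>j. (\<integral>\<theta>. (\<tau> i (\<theta> $ i) (f \<theta> $ i) - \<tau> j (\<theta> $ j) (f \<theta> $ j)) * \<pi> \<theta> m \<partial>P) \<le> 0)))"

text \<open>For affine increasing delays and square-integrable states, every rule has a BWE and any two agree \<open>P\<close>-almost everywhere, so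
  the cost of \<open>BWE_flow\<close> does not depend on the choice.\<close>

definition BWE_flow ::
  "('e \<Rightarrow> real \<Rightarrow> real \<Rightarrow> real) \<Rightarrow> (real ^ 'e::finite) measure \<Rightarrow> 'm set \<Rightarrow>
     (real ^ 'e \<Rightarrow> 'm \<Rightarrow> real) \<Rightarrow> real ^ 'e \<Rightarrow> real ^ 'e" where
  "BWE_flow \<tau> P M \<pi> = (SOME f. is_BWE \<tau> P M \<pi> f)"

definition rule_cost ::
  "('e \<Rightarrow> real \<Rightarrow> real \<Rightarrow> real) \<Rightarrow> (real ^ 'e::finite) measure \<Rightarrow> 'm set \<Rightarrow>
     (real ^ 'e \<Rightarrow> 'm \<Rightarrow> real) \<Rightarrow> real" where
  "rule_cost \<tau> P M \<pi> = flow_cost \<tau> P (BWE_flow \<tau> P M \<pi>)"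

text \<open>Competing rules range over all finite message sets drawn from \<open>'n\<close>. HOL cannot quantify over
  \<open>'n\<close> inside the definition; a theorem that leaves \<open>'n\<close> free covers all finite message sets.\<close>

definition optimal_rule ::
  "'n itself \<Rightarrow> ('e \<Rightarrow> real \<Rightarrow> real \<Rightarrow> real) \<Rightarrow> (real ^ 'e::finite) measure \<Rightarrow> 'm set \<Rightarrow>
     (real ^ 'e \<Rightarrow> 'm \<Rightarrow> real) \<Rightarrow> bool" where
  "optimal_rule _ \<tau> P M \<pi> \<longleftrightarrow>
     signaling_rule M \<pi> \<and>
     (\<forall>(M' :: 'n set) \<pi>'. signaling_rule M' \<pi>' \<longrightarrow> rule_cost \<tau> P M \<pi> \<le> rule_cost \<tau> P M' \<pi>')"

definition direct_rule ::
  "(real ^ 'e::finite \<Rightarrow> real ^ 'e) \<Rightarrow> real ^ 'e \<Rightarrow> 'e \<Rightarrow> real" where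
  "direct_rule f \<theta> e = f \<theta> $ e"

end

theory Submission
  imports Defs
begin

text \<open>
  No flow costs less than \<open>f*\<close>, so it suffices that \<open>f*\<close> is itself the equilibrium of the direct
  rule when every user follows the recommendation. On the support of the law, \<open>f*\<close> is interior and
  \<open>f*_e = \<alpha>_e / 2 (\<lambda> - \<theta>_e)\<close> with \<open>\<lambda> = (2 + \<Sum> \<alpha>_k \<theta>_k) / \<Sum> \<alpha>_k\<close>, so that the delay of \<open>e\<close> is
  \<open>(\<lambda> + \<theta>_e) / 2\<close>. Obedience to recommendation \<open>i\<close> against \<open>j\<close> then says that
  \<open>E[(\<Theta>_i - \<Theta>_j) (\<lambda> - \<Theta>_i)] \<le> 0\<close>. With equal means and uncorrelated states of variances \<open>V\<close>, the left-hand
  side is \<open>(\<alpha>_i V_i - \<alpha>_j V_j) / \<Sum> \<alpha>_k - V_i\<close>, which is nonpositive.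

  Since \<open>BWE_flow\<close> is a choice, comparing costs needs that every rule has an equilibrium and that its
  cost is unique; both come from the variational inequality that characterizes equilibria.
\<close>

definition affine_delay :: "('e \<Rightarrow> real) \<Rightarrow> 'e \<Rightarrow> real \<Rightarrow> real \<Rightarrow> real" where
  "affine_delay \<alpha> e t x = x / \<alpha> e + t"

section \<open>The simplex of flows\<close>

lemma flows_nonneg: "x \<in> flows \<Longrightarrow> 0 \<le> x $ e"
  by (simp add: flows_def orthant_def)

lemma flows_sum: "x \<in> flows \<Longrightarrow> (\<Sum>e\<in>UNIV. x $ e) = 1"
  by (simp add: flows_def)

lemma flows_le_1:
  assumes "x \<in> flows" shows "x $ e \<le> 1"
  using member_le_sum[of e UNIV "\<lambda>e. x $ e"] flows_nonneg[OF assms] flows_sum[OF assms] by simp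

lemma axis_in_flows: "axis e 1 \<in> flows"
  by (simp add: flows_def orthant_def axis_def)

lemma convex_flows: "convex flows"
  unfolding convex_def flows_def orthant_def
  by (auto simp: sum.distrib simp flip: sum_distrib_left)

lemma compact_flows: "compact (flows :: (real ^ 'e::finite) set)"
proof -
  have eq: "flows = (\<Inter>e. {x :: real ^ 'e. 0 \<le> x $ e}) \<inter> {x. (\<Sum>e\<in>UNIV. x $ e) = 1}"
    by (auto simp: flows_def orthant_def)
  have "closed (flows :: (real ^ 'e) set)"
    unfolding eq
    by (intro closed_Int closed_INT ballI closed_Collect_le closed_Collect_eq continuous_intros)
  moreover have "norm x \<le> 1" if "x \<in> flows" for x :: "real ^ 'e"
    using norm_le_l1_cart[of x] flows_nonneg[OF that] flows_sum[OF that] by simp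
  then have "bounded (flows :: (real ^ 'e) set)"
    by (auto simp: bounded_iff)
  ultimately show ?thesis
    by (simp add: compact_eq_bounded_closed)
qed

text \<open>A linear function on the simplex is minimized exactly by the flows that use only links
  of least coefficient. This converts between Wardrop conditions and variational inequalities, both
  for the optimum and for equilibria.\<close>

lemma flows_variational_iff:
  assumes x: "x \<in> flows"
  shows "(\<forall>v\<in>flows. c \<bullet> x \<le> c \<bullet> v) \<longleftrightarrow> (\<forall>i j. 0 < x $ i \<longrightarrow> c $ i \<le> c $ j)"
proof (intro iffI allI impI ballI)
  fix i j
  assume vi: "\<forall>v\<in>flows. c \<bullet> x \<le> c \<bullet> v" and pos: "0 < x $ i"
  \<comment> \<open>All the flow of link \<open>i\<close> is moved to link \<open>j\<close>; the
    cost then changes by \<open>x $ i * (c $ j - c $ i)\<close>.\<close>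
  define v where "v = x + (x $ i) *\<^sub>R (axis j 1 - axis i 1)"
  have "0 \<le> v $ e" for e
    using flows_nonneg[OF x, of e] pos by (auto simp: v_def axis_def)
  moreover have "(\<Sum>e\<in>UNIV. v $ e) = 1"
    using flows_sum[OF x]
    by (simp add: v_def sum.distrib flows_sum[OF axis_in_flows] sum_subtractf
        flip: sum_distrib_left)
  ultimately have "c \<bullet> x \<le> c \<bullet> v"
    using vi by (simp add: flows_def orthant_def)
  then have "0 \<le> x $ i * (c $ j - c $ i)"
    by (simp add: v_def inner_add_right inner_diff_right inner_axis)
  with pos show "c $ i \<le> c $ j"
    by (simp add: zero_le_mult_iff)
next
  fix v :: "real ^ 'a"
  assume w: "\<forall>i j. 0 < x $ i \<longrightarrow> c $ i \<le> c $ j" and v: "v \<in> flows"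
  obtain i where i: "0 < x $ i"
    using flows_sum[OF x] sum_nonpos[of UNIV "\<lambda>e. x $ e"] by (metis not_le zero_less_one)
  have "c $ k * x $ k = c $ i * x $ k" for k
    using w i flows_nonneg[OF x, of k] by (cases "x $ k = 0") (auto simp: less_le intro: antisym)
  then have "c \<bullet> x = c $ i"
    using flows_sum[OF x] by (simp only: inner_vec_def inner_real_def sum_distrib_left[symmetric] mult_1_right)
  also have "\<dots> = (\<Sum>k\<in>UNIV. c $ i * v $ k)"
    using flows_sum[OF v] by (simp flip: sum_distrib_left)
  also have "\<dots> \<le> c \<bullet> v"
    using w i flows_nonneg[OF v] by (auto simp: inner_vec_def intro!: sum_mono mult_right_mono)
  finally show "c \<bullet> x \<le> c \<bullet> v" .
qed

section \<open>The system optimum\<close>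

text \<open>For small \<open>t\<close> the linear term dominates the quadratic one. First-order
  conditions follow from this without any differentiation.\<close>

lemma linear_part_nonneg:
  fixes a b :: real
  assumes "\<And>t. 0 < t \<Longrightarrow> t \<le> 1 \<Longrightarrow> 0 \<le> t * a + t\<^sup>2 * b"
  shows "0 \<le> a"
proof (rule ccontr)
  assume "\<not> 0 \<le> a"
  \<comment> \<open>This choice bounds \<open>t * b\<close> by half of \<open>- a\<close>; the
    \<open>+ 1\<close> keeps the denominator positive when \<open>b = 0\<close>.\<close>
  define t where "t = min 1 (- a / (2 * (\<bar>b\<bar> + 1)))"
  have t: "0 < t" "t \<le> 1"
    using \<open>\<not> 0 \<le> a\<close> by (auto simp: t_def field_simps)
  have "t * b \<le> t * (\<bar>b\<bar> + 1)"
    using t by (intro mult_left_mono) auto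
  also have "\<dots> \<le> - a / (2 * (\<bar>b\<bar> + 1)) * (\<bar>b\<bar> + 1)"
    by (intro mult_right_mono) (auto simp: t_def)
  also have "\<dots> = - a / 2"
    by (simp add: divide_simps)
  finally have "t * (a + t * b) < 0"
    using t \<open>\<not> 0 \<le> a\<close> by (intro mult_pos_neg) auto
  with assms[OF t] show False
    by (simp add: algebra_simps power2_eq_square)
qed

text \<open>The total delay is quadratic, so its second-order expansion is exact; the gradient
  \<open>2 * x $ e / \<alpha> e + \<theta> $ e\<close> is the marginal cost of link
  \<open>e\<close>.\<close>

lemma total_delay_add:
  "total_delay (affine_delay \<alpha>) \<theta> (x + d) =
     total_delay (affine_delay \<alpha>) \<theta> x + (\<chi> e. 2 * x $ e / \<alpha> e + \<theta> $ e) \<bullet> d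
     + (\<Sum>e\<in>UNIV. (d $ e)\<^sup>2 / \<alpha> e)"
  unfolding total_delay_def affine_delay_def inner_vec_def sum.distrib[symmetric]
  by (intro sum.cong refl) (simp add: algebra_simps power2_eq_square add_divide_distrib)

locale affine_delays =
  fixes \<alpha> :: "'e::finite \<Rightarrow> real"
  assumes \<alpha>_pos: "0 < \<alpha> e"
begin

text \<open>\<open>ARG_MIN\<close> is a choice, so a minimizer must first be exhibited: a continuous
  function attains its infimum on the compact simplex.\<close>

lemma is_arg_min_system_optimum:
  "is_arg_min (total_delay (affine_delay \<alpha>) \<theta>) (\<lambda>x. x \<in> flows)
     (system_optimum (affine_delay \<alpha>) \<theta>)"
proof -
  have "continuous_on flows (total_delay (affine_delay \<alpha>) \<theta>)"
    unfolding total_delay_def affine_delay_def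
    using \<alpha>_pos by (intro continuous_intros) (metis less_irrefl)
  then obtain x where "x \<in> flows"
    "\<forall>y\<in>flows. total_delay (affine_delay \<alpha>) \<theta> x \<le> total_delay (affine_delay \<alpha>) \<theta> y"
    using continuous_attains_inf[OF compact_flows] axis_in_flows by (metis empty_iff)
  then have "is_arg_min (total_delay (affine_delay \<alpha>) \<theta>) (\<lambda>x. x \<in> flows) x"
    by (simp add: is_arg_min_linorder)
  then show ?thesis
    unfolding system_optimum_def arg_min_def by (rule someI)
qed

lemma system_optimum_in_flows: "system_optimum (affine_delay \<alpha>) \<theta> \<in> flows"
  using is_arg_min_system_optimum by (simp add: is_arg_min_def)

lemma system_optimum_le:
  "v \<in> flows \<Longrightarrow>
    total_delay (affine_delay \<alpha>) \<theta> (system_optimum (affine_delay \<alpha>) \<theta>)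
      \<le> total_delay (affine_delay \<alpha>) \<theta> v"
  using is_arg_min_system_optimum by (simp add: is_arg_min_linorder)

text \<open>First-order optimality along the segment from \<open>x\<close> to \<open>v\<close>,
  which stays in the simplex by convexity.\<close>

lemma system_optimum_variational:
  fixes \<theta> :: "real ^ 'e"
  defines "x \<equiv> system_optimum (affine_delay \<alpha>) \<theta>"
  assumes v: "v \<in> flows"
  shows "(\<chi> e. 2 * x $ e / \<alpha> e + \<theta> $ e) \<bullet> x \<le> (\<chi> e. 2 * x $ e / \<alpha> e + \<theta> $ e) \<bullet> v"
proof -
  have "0 \<le> (\<chi> e. 2 * x $ e / \<alpha> e + \<theta> $ e) \<bullet> (v - x)"
  proof (rule linear_part_nonneg)
    fix t :: real assume t: "0 < t" "t \<le> 1"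
    have "(1 - t) *\<^sub>R x + t *\<^sub>R v \<in> flows"
      using t v system_optimum_in_flows convex_flows by (intro convexD) (auto simp: x_def)
    moreover have "(1 - t) *\<^sub>R x + t *\<^sub>R v = x + t *\<^sub>R (v - x)"
      by (simp add: algebra_simps)
    ultimately have "total_delay (affine_delay \<alpha>) \<theta> x
        \<le> total_delay (affine_delay \<alpha>) \<theta> (x + t *\<^sub>R (v - x))"
      unfolding x_def by (metis system_optimum_le)
    then show "0 \<le> t * ((\<chi> e. 2 * x $ e / \<alpha> e + \<theta> $ e) \<bullet> (v - x))
        + t\<^sup>2 * (\<Sum>e\<in>UNIV. ((v - x) $ e)\<^sup>2 / \<alpha> e)"
      unfolding total_delay_add
      by (simp add: power_mult_distrib sum_distrib_left)
  qed
  then show ?thesis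
    by (simp add: inner_diff_right)
qed

text \<open>Each of the two variational inequalities is tested at the other optimum. Their sum
  bounds the strongly convex quadratic part by the change of state. The resulting continuity makes
  the direct rule measurable.\<close>

lemma system_optimum_lipschitz:
  "dist (system_optimum (affine_delay \<alpha>) \<theta>) (system_optimum (affine_delay \<alpha>) \<theta>')
     \<le> (\<Sum>e\<in>UNIV. \<alpha> e) / 2 * dist \<theta> \<theta>'"
proof -
  define x where "x = system_optimum (affine_delay \<alpha>) \<theta>"
  define x' where "x' = system_optimum (affine_delay \<alpha>) \<theta>'"
  define A where "A = (\<Sum>e\<in>UNIV. \<alpha> e)"
  have A: "\<alpha> e \<le> A" for e
    unfolding A_def using \<alpha>_pos by (intro member_le_sum) (auto intro: less_imp_le)
  then have A_pos: "0 < A"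
    using \<alpha>_pos less_le_trans by blast
  have "(norm (x - x'))\<^sup>2 / A = (\<Sum>e\<in>UNIV. (x $ e - x' $ e)\<^sup>2 / A)"
    unfolding power2_norm_eq_inner inner_vec_def sum_divide_distrib
    by (simp add: power2_eq_square)
  also have "\<dots> \<le> (\<Sum>e\<in>UNIV. (x $ e - x' $ e)\<^sup>2 / \<alpha> e)"
    using A \<alpha>_pos A_pos by (intro sum_mono divide_left_mono) auto
  finally have 1: "(norm (x - x'))\<^sup>2 / A \<le> (\<Sum>e\<in>UNIV. (x $ e - x' $ e)\<^sup>2 / \<alpha> e)" .
  have "(\<chi> e. 2 * x $ e / \<alpha> e + \<theta> $ e) \<bullet> x \<le> (\<chi> e. 2 * x $ e / \<alpha> e + \<theta> $ e) \<bullet> x'"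
    "(\<chi> e. 2 * x' $ e / \<alpha> e + \<theta>' $ e) \<bullet> x' \<le> (\<chi> e. 2 * x' $ e / \<alpha> e + \<theta>' $ e) \<bullet> x"
    unfolding x_def x'_def by (rule system_optimum_variational system_optimum_in_flows)+
  moreover have "(\<chi> e. 2 * x $ e / \<alpha> e + \<theta> $ e) \<bullet> (x' - x) + (\<chi> e. 2 * x' $ e / \<alpha> e + \<theta>' $ e) \<bullet> (x - x')
      = (\<theta> - \<theta>') \<bullet> (x' - x) - 2 * (\<Sum>e\<in>UNIV. (x $ e - x' $ e)\<^sup>2 / \<alpha> e)"
    unfolding inner_vec_def sum_distrib_left sum.distrib[symmetric] sum_subtractf[symmetric]
    by (intro sum.cong refl)
      (simp add: algebra_simps power2_eq_square add_divide_distrib diff_divide_distrib)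
  ultimately have "2 * (\<Sum>e\<in>UNIV. (x $ e - x' $ e)\<^sup>2 / \<alpha> e) \<le> (\<theta> - \<theta>') \<bullet> (x' - x)"
    by (simp add: inner_diff_right)
  also have "\<dots> \<le> norm (\<theta> - \<theta>') * norm (x - x')"
    by (metis norm_cauchy_schwarz norm_minus_commute)
  finally have "2 * ((norm (x - x'))\<^sup>2 / A) \<le> norm (\<theta> - \<theta>') * norm (x - x')"
    using 1 by linarith
  then have "norm (x - x') * (norm (x - x')) \<le> norm (x - x') * (A / 2 * norm (\<theta> - \<theta>'))"
    using A_pos by (simp add: field_simps power2_eq_square)
  then have "norm (x - x') \<le> A / 2 * norm (\<theta> - \<theta>')"
    using A_pos by (cases "norm (x - x') = 0") (auto simp: mult_le_cancel_left)
  then show ?thesis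
    by (simp add: x_def x'_def A_def dist_norm)
qed

lemma continuous_on_system_optimum: "continuous_on S (system_optimum (affine_delay \<alpha>))"
  by (rule lipschitz_on_continuous_on[of "(\<Sum>e\<in>UNIV. \<alpha> e) / 2"], rule lipschitz_onI)
    (use system_optimum_lipschitz in \<open>auto intro!: sum_nonneg \<alpha>_pos[THEN less_imp_le]\<close>)

text \<open>When every link is used, all marginal costs equal one multiplier \<open>l\<close>, and
  the unit throughput determines \<open>l\<close>.\<close>

lemma system_optimum_interior:
  fixes \<theta> :: "real ^ 'e"
  defines "x \<equiv> system_optimum (affine_delay \<alpha>) \<theta>"
  assumes pos: "\<And>e. 0 < x $ e"
  shows "x $ i = \<alpha> i / 2 * ((2 + (\<Sum>k\<in>UNIV. \<alpha> k * \<theta> $ k)) / (\<Sum>k\<in>UNIV. \<alpha> k) - \<theta> $ i)"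
proof -
  define A where "A = (\<Sum>k\<in>UNIV. \<alpha> k)"
  define l where "l = 2 * x $ i / \<alpha> i + \<theta> $ i"
  have A_pos: "0 < A"
    unfolding A_def using \<alpha>_pos by (intro sum_pos) auto
  have "2 * x $ j / \<alpha> j + \<theta> $ j \<le> 2 * x $ k / \<alpha> k + \<theta> $ k" for j k
    using flows_variational_iff[of x "\<chi> e. 2 * x $ e / \<alpha> e + \<theta> $ e"]
      system_optimum_variational[of _ \<theta>] system_optimum_in_flows pos[of j]
    by (auto simp: x_def)
  then have "2 * x $ k / \<alpha> k + \<theta> $ k = l" for k
    unfolding l_def by (intro antisym)
  then have "2 * x $ k / \<alpha> k = l - \<theta> $ k" for k
    by (simp add: eq_diff_eq)
  then have eq: "2 * x $ k = \<alpha> k * (l - \<theta> $ k)" for k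
    using \<alpha>_pos[of k] by (metis less_irrefl nonzero_eq_divide_eq mult.commute)
  \<comment> \<open>Summing \<open>eq\<close> over all links, whose flows add up to 1, leaves a
    linear equation for \<open>l\<close>.\<close>
  have "2 = (\<Sum>k\<in>UNIV. 2 * x $ k)"
    using flows_sum[OF system_optimum_in_flows[of \<theta>]] by (simp add: x_def flip: sum_distrib_left)
  also have "\<dots> = l * A - (\<Sum>k\<in>UNIV. \<alpha> k * \<theta> $ k)"
    unfolding eq by (simp add: A_def right_diff_distrib sum_subtractf sum_distrib_left mult.commute)
  finally have "l = (2 + (\<Sum>k\<in>UNIV. \<alpha> k * \<theta> $ k)) / A"
    using A_pos by (simp add: field_simps)
  with eq[of i] show ?thesis
    by (simp add: A_def)
qed

end

section \<open>Equilibria of signaling rules\<close>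

lemma response_iff: "response M y \<longleftrightarrow> (\<forall>m\<in>M. (\<chi> e. y e m) \<in> flows)"
  by (simp add: response_def flows_def orthant_def)

lemma signaling_rule_nonneg:
  "signaling_rule M \<pi> \<Longrightarrow> m \<in> M \<Longrightarrow> \<theta> \<in> orthant \<Longrightarrow> 0 \<le> \<pi> \<theta> m"
  by (simp add: signaling_rule_def)

lemma signaling_rule_sum:
  "signaling_rule M \<pi> \<Longrightarrow> \<theta> \<in> orthant \<Longrightarrow> (\<Sum>m\<in>M. \<pi> \<theta> m) = 1"
  by (simp add: signaling_rule_def)

lemma signaling_rule_finite: "signaling_rule M \<pi> \<Longrightarrow> finite M"
  by (simp add: signaling_rule_def)

lemma signaling_rule_abs_le_1:
  assumes "signaling_rule M \<pi>" "m \<in> M" "\<theta> \<in> orthant"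
  shows "\<bar>\<pi> \<theta> m\<bar> \<le> 1"
  using member_le_sum[of m M "\<pi> \<theta>"] signaling_rule_nonneg[OF assms(1) _ assms(3)]
    signaling_rule_sum[OF assms(1,3)] signaling_rule_finite[OF assms(1)] assms(2)
  by simp

lemma space_orthant_borel: "space orthant_borel = orthant"
  by (simp add: orthant_borel_def space_restrict_space)

lemma induced_flow_in_flows:
  assumes "signaling_rule M \<pi>" "response M y" "\<theta> \<in> orthant"
  shows "induced_flow M \<pi> y \<theta> \<in> flows"
proof -
  have "(\<Sum>e\<in>UNIV. \<Sum>m\<in>M. y e m * \<pi> \<theta> m) = (\<Sum>m\<in>M. (\<Sum>e\<in>UNIV. y e m) * \<pi> \<theta> m)"
    by (subst sum.swap) (simp add: sum_distrib_right)
  also have "\<dots> = 1"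
    using assms(2) signaling_rule_sum[OF assms(1,3)] by (simp add: response_def)
  finally show ?thesis
    using assms by (auto simp: flows_def orthant_def induced_flow_def response_def
        intro!: sum_nonneg mult_nonneg_nonneg signaling_rule_nonneg[OF assms(1)])
qed

section \<open>Integrability of delays under the law of the state\<close>

text \<open>Flows and messages are bounded by 1, so first moments make all delays integrable. Second
  moments enter where products of states are integrated.\<close>

locale network_state = prob_space P for P :: "(real ^ 'e::finite) measure" +
  assumes sets_P: "sets P = sets orthant_borel"
    and integrable_state: "integrable P (\<lambda>\<theta>. \<theta> $ e)"
begin

lemma space_P: "space P = orthant"
  using sets_eq_imp_space_eq[OF sets_P] by (simp add: space_orthant_borel)

lemma measurable_message:
  "signaling_rule M \<pi> \<Longrightarrow> m \<in> M \<Longrightarrow> (\<lambda>\<theta>. \<pi> \<theta> m) \<in> borel_measurable P"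
  by (simp add: signaling_rule_def measurable_cong_sets[OF sets_P refl])

lemma integrable_mult_bounded:
  fixes g h :: "real ^ 'e \<Rightarrow> real"
  assumes g: "integrable P g" and h: "h \<in> borel_measurable P"
    and le: "\<And>\<theta>. \<theta> \<in> orthant \<Longrightarrow> \<bar>h \<theta>\<bar> \<le> 1"
  shows "integrable P (\<lambda>\<theta>. g \<theta> * h \<theta>)"
proof (rule Bochner_Integration.integrable_bound[OF g])
  show "(\<lambda>\<theta>. g \<theta> * h \<theta>) \<in> borel_measurable P"
    using borel_measurable_integrable[OF g] h by simp
  show "AE \<theta> in P. norm (g \<theta> * h \<theta>) \<le> norm (g \<theta>)"
    using le by (intro AE_I2) (auto simp: space_P abs_mult intro!: mult_left_le)
qed

lemma integrable_mult_message:
  "signaling_rule M \<pi> \<Longrightarrow> m \<in> M \<Longrightarrow> integrable P g \<Longrightarrow> integrable P (\<lambda>\<theta>. g \<theta> * \<pi> \<theta> m)"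
  by (intro integrable_mult_bounded measurable_message signaling_rule_abs_le_1)

lemma integrable_message:
  "signaling_rule M \<pi> \<Longrightarrow> m \<in> M \<Longrightarrow> integrable P (\<lambda>\<theta>. \<pi> \<theta> m)"
  using integrable_mult_message[of M \<pi> m "\<lambda>_. 1"] by simp

definition admissible :: "(real ^ 'e \<Rightarrow> real ^ 'e) \<Rightarrow> bool" where
  "admissible f \<longleftrightarrow> (\<forall>e. (\<lambda>\<theta>. f \<theta> $ e) \<in> borel_measurable P) \<and> (\<forall>\<theta>\<in>orthant. f \<theta> \<in> flows)"

lemma admissible_induced_flow:
  "signaling_rule M \<pi> \<Longrightarrow> response M y \<Longrightarrow> admissible (induced_flow M \<pi> y)"
  using induced_flow_in_flows[of M \<pi> y] measurable_message[of M \<pi>]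
  by (auto simp: admissible_def induced_flow_def[of M \<pi> y]
      intro!: borel_measurable_sum borel_measurable_times)

lemma admissible_abs_le_1: "admissible f \<Longrightarrow> \<theta> \<in> orthant \<Longrightarrow> \<bar>f \<theta> $ e\<bar> \<le> 1"
  using flows_nonneg[of "f \<theta>" e] flows_le_1[of "f \<theta>" e] by (simp add: admissible_def)

lemma integrable_mult_flow:
  "admissible f \<Longrightarrow> integrable P g \<Longrightarrow> integrable P (\<lambda>\<theta>. g \<theta> * f \<theta> $ e)"
  by (intro integrable_mult_bounded admissible_abs_le_1) (simp_all add: admissible_def)

lemma integrable_delay:
  assumes "admissible f"
  shows "integrable P (\<lambda>\<theta>. affine_delay \<alpha> e (\<theta> $ e) (f \<theta> $ e))"
  using integrable_mult_flow[OF assms, of "\<lambda>_. 1" e]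
  by (simp add: affine_delay_def integrable_state)

lemma integrable_total_delay:
  assumes "admissible f" "admissible g"
  shows "integrable P (\<lambda>\<theta>. \<Sum>e\<in>UNIV. g \<theta> $ e * affine_delay \<alpha> e (\<theta> $ e) (f \<theta> $ e))"
  using integrable_mult_flow[OF assms(2) integrable_delay[OF assms(1)]]
  by (simp add: mult.commute)

text \<open>The delay of each link weighted by the users who receive message \<open>m\<close>: \<open>is_BWE\<close> says that every
  \<open>\<chi> e. y e m\<close> is a Wardrop flow for these weighted delays.\<close>

definition message_delay ::
  "('e \<Rightarrow> real) \<Rightarrow> (real ^ 'e \<Rightarrow> 'm \<Rightarrow> real) \<Rightarrow> (real ^ 'e \<Rightarrow> real ^ 'e) \<Rightarrow> 'm \<Rightarrow> real ^ 'e" where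
  "message_delay \<alpha> \<pi> f m = (\<chi> e. \<integral>\<theta>. affine_delay \<alpha> e (\<theta> $ e) (f \<theta> $ e) * \<pi> \<theta> m \<partial>P)"

lemma integral_delay_diff:
  assumes "signaling_rule M \<pi>" "m \<in> M" "admissible f"
  shows "(\<integral>\<theta>. (affine_delay \<alpha> i (\<theta> $ i) (f \<theta> $ i) - affine_delay \<alpha> j (\<theta> $ j) (f \<theta> $ j)) * \<pi> \<theta> m \<partial>P)
    = message_delay \<alpha> \<pi> f m $ i - message_delay \<alpha> \<pi> f m $ j"
  by (simp add: message_delay_def left_diff_distrib
      integrable_mult_message[OF assms(1,2) integrable_delay[OF assms(3)]])

text \<open>For each message, the Wardrop condition is \<open>flows_variational_iff\<close> with the
  vector of weighted delays as coefficients.\<close>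

lemma is_BWE_iff_variational:
  assumes \<pi>: "signaling_rule M \<pi>"
  shows "is_BWE (affine_delay \<alpha>) P M \<pi> f \<longleftrightarrow>
    (\<exists>y. response M y \<and> f = induced_flow M \<pi> y \<and>
      (\<forall>m\<in>M. \<forall>v\<in>flows. message_delay \<alpha> \<pi> f m \<bullet> (\<chi> e. y e m) \<le> message_delay \<alpha> \<pi> f m \<bullet> v))"
proof -
  have eq: "(\<forall>m\<in>M. \<forall>i. y i m > 0 \<longrightarrow> (\<forall>j. (\<integral>\<theta>. (affine_delay \<alpha> i (\<theta> $ i) (f \<theta> $ i)
            - affine_delay \<alpha> j (\<theta> $ j) (f \<theta> $ j)) * \<pi> \<theta> m \<partial>P) \<le> 0)) \<longleftrightarrow>
      (\<forall>m\<in>M. \<forall>v\<in>flows. message_delay \<alpha> \<pi> f m \<bullet> (\<chi> e. y e m) \<le> message_delay \<alpha> \<pi> f m \<bullet> v)"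
    if y: "response M y" and f: "f = induced_flow M \<pi> y" for y
  proof (intro ball_cong refl)
    fix m assume m: "m \<in> M"
    have "admissible f"
      using admissible_induced_flow[OF \<pi> y] f by simp
    moreover have "(\<chi> e. y e m) \<in> flows"
      using y m by (simp add: response_iff)
    ultimately show "(\<forall>i. y i m > 0 \<longrightarrow> (\<forall>j. (\<integral>\<theta>. (affine_delay \<alpha> i (\<theta> $ i) (f \<theta> $ i)
            - affine_delay \<alpha> j (\<theta> $ j) (f \<theta> $ j)) * \<pi> \<theta> m \<partial>P) \<le> 0)) \<longleftrightarrow>
        (\<forall>v\<in>flows. message_delay \<alpha> \<pi> f m \<bullet> (\<chi> e. y e m) \<le> message_delay \<alpha> \<pi> f m \<bullet> v)"
      by (simp add: flows_variational_iff integral_delay_diff[OF \<pi> m])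
  qed
  then show ?thesis
    unfolding is_BWE_def by (intro ex_cong1 conj_cong refl) (rule eq)
qed

text \<open>With the delays frozen at \<open>f\<close>, the expected delay is linear in the response
  \<open>z\<close> and splits into one term per message.\<close>

lemma integral_delay_induced_flow:
  assumes \<pi>: "signaling_rule M \<pi>" and f: "admissible f"
  shows "(\<integral>\<theta>. (\<Sum>e\<in>UNIV. induced_flow M \<pi> z \<theta> $ e * affine_delay \<alpha> e (\<theta> $ e) (f \<theta> $ e)) \<partial>P)
    = (\<Sum>m\<in>M. message_delay \<alpha> \<pi> f m \<bullet> (\<chi> e. z e m))"
proof -
  have int: "integrable P (\<lambda>\<theta>. z e m * (affine_delay \<alpha> e (\<theta> $ e) (f \<theta> $ e) * \<pi> \<theta> m))"
    if "m \<in> M" for e m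
    using integrable_mult_message[OF \<pi> that integrable_delay[OF f]] by simp
  have "(\<integral>\<theta>. (\<Sum>e\<in>UNIV. induced_flow M \<pi> z \<theta> $ e * affine_delay \<alpha> e (\<theta> $ e) (f \<theta> $ e)) \<partial>P)
    = (\<integral>\<theta>. (\<Sum>e\<in>UNIV. \<Sum>m\<in>M. z e m * (affine_delay \<alpha> e (\<theta> $ e) (f \<theta> $ e) * \<pi> \<theta> m)) \<partial>P)"
    by (simp add: induced_flow_def sum_distrib_right mult_ac)
  also have "\<dots> = (\<Sum>e\<in>UNIV. \<Sum>m\<in>M. z e m * message_delay \<alpha> \<pi> f m $ e)"
    using int by (simp add: Bochner_Integration.integral_sum message_delay_def)
  also have "\<dots> = (\<Sum>m\<in>M. message_delay \<alpha> \<pi> f m \<bullet> (\<chi> e. z e m))"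
    by (subst sum.swap) (simp add: inner_vec_def mult.commute)
  finally show ?thesis .
qed

section \<open>Uniqueness of equilibria\<close>

text \<open>The variational inequalities are summed over the messages: at the delays of the
  equilibrium, no other response has a smaller expected delay.\<close>

lemma BWE_integral_delay_le:
  assumes \<pi>: "signaling_rule M \<pi>" and f: "is_BWE (affine_delay \<alpha>) P M \<pi> f"
    and z: "response M z"
  shows "(\<integral>\<theta>. (\<Sum>e\<in>UNIV. f \<theta> $ e * affine_delay \<alpha> e (\<theta> $ e) (f \<theta> $ e)) \<partial>P)
    \<le> (\<integral>\<theta>. (\<Sum>e\<in>UNIV. induced_flow M \<pi> z \<theta> $ e * affine_delay \<alpha> e (\<theta> $ e) (f \<theta> $ e)) \<partial>P)"
proof -
  obtain y where y: "response M y" "f = induced_flow M \<pi> y"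
    and vi: "\<And>m v. m \<in> M \<Longrightarrow> v \<in> flows \<Longrightarrow>
      message_delay \<alpha> \<pi> f m \<bullet> (\<chi> e. y e m) \<le> message_delay \<alpha> \<pi> f m \<bullet> v"
    using f unfolding is_BWE_iff_variational[OF \<pi>] by metis
  have adm: "admissible f"
    using admissible_induced_flow[OF \<pi> y(1)] y(2) by simp
  have "(\<Sum>m\<in>M. message_delay \<alpha> \<pi> f m \<bullet> (\<chi> e. y e m))
      \<le> (\<Sum>m\<in>M. message_delay \<alpha> \<pi> f m \<bullet> (\<chi> e. z e m))"
    using vi z by (intro sum_mono) (auto simp: response_iff)
  then show ?thesis
    using integral_delay_induced_flow[OF \<pi> adm, of y \<alpha>]
      integral_delay_induced_flow[OF \<pi> adm, of z \<alpha>] y(2) by simp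
qed

lemma BWE_admissible:
  "signaling_rule M \<pi> \<Longrightarrow> is_BWE \<tau> P M \<pi> f \<Longrightarrow> admissible f"
  by (auto simp: is_BWE_def intro: admissible_induced_flow)

text \<open>Delays are strictly increasing in the flow. Testing each equilibrium against the other
  and adding gives a nonpositive integral of a weighted sum of squares, which therefore vanishes
  almost everywhere.\<close>

lemma BWE_unique:
  assumes \<alpha>_pos: "\<And>e. 0 < \<alpha> e" and \<pi>: "signaling_rule M \<pi>"
    and f: "is_BWE (affine_delay \<alpha>) P M \<pi> f" and g: "is_BWE (affine_delay \<alpha>) P M \<pi> g"
  shows "AE \<theta> in P. f \<theta> = g \<theta>"
proof -
  let ?I = "\<lambda>f g \<theta>. \<Sum>e\<in>UNIV. g \<theta> $ e * affine_delay \<alpha> e (\<theta> $ e) (f \<theta> $ e)"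
  let ?D = "\<lambda>\<theta>. \<Sum>e\<in>UNIV. (f \<theta> $ e - g \<theta> $ e)\<^sup>2 / \<alpha> e"
  note adm = BWE_admissible[OF \<pi> f] BWE_admissible[OF \<pi> g]
  \<comment> \<open>The states cancel, as they enter the delays of \<open>f\<close> and
    \<open>g\<close> alike.\<close>
  have D: "?D = (\<lambda>\<theta>. (?I f f \<theta> - ?I f g \<theta>) + (?I g g \<theta> - ?I g f \<theta>))"
    unfolding sum.distrib[symmetric] sum_subtractf[symmetric] affine_delay_def
    by (intro ext sum.cong refl)
      (simp add: algebra_simps power2_eq_square add_divide_distrib diff_divide_distrib)
  have int: "integrable P ?D"
    unfolding D by (intro Bochner_Integration.integrable_add Bochner_Integration.integrable_diff
        integrable_total_delay adm)
  have "(\<integral>\<theta>. ?I f f \<theta> \<partial>P) \<le> (\<integral>\<theta>. ?I f g \<theta> \<partial>P)" "(\<integral>\<theta>. ?I g g \<theta> \<partial>P) \<le> (\<integral>\<theta>. ?I g f \<theta> \<partial>P)"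
    using BWE_integral_delay_le[OF \<pi> f] BWE_integral_delay_le[OF \<pi> g] f g
    by (auto simp: is_BWE_def)
  then have "(\<integral>\<theta>. ?D \<theta> \<partial>P) \<le> 0"
    unfolding D by (simp add: integrable_total_delay adm)
  moreover have nonneg: "0 \<le> (f \<theta> $ e - g \<theta> $ e)\<^sup>2 / \<alpha> e" for \<theta> e
    using \<alpha>_pos[of e] by simp
  ultimately have "AE \<theta> in P. ?D \<theta> = 0"
    using integral_nonneg_eq_0_iff_AE[OF int] integral_nonneg_AE[of ?D P]
    by (simp add: sum_nonneg order_antisym)
  then show ?thesis
    using \<alpha>_pos nonneg
    by (auto elim!: eventually_mono simp: sum_nonneg_eq_0_iff vec_eq_iff less_imp_neq[symmetric])
qed

section \<open>Existence of equilibria\<close>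

text \<open>The cost is a quadratic polynomial in the entries of \<open>y\<close>, which makes its
  continuity in the response evident.\<close>

lemma flow_cost_induced_flow:
  assumes \<pi>: "signaling_rule M \<pi>"
  shows "flow_cost (affine_delay \<alpha>) P (induced_flow M \<pi> y) =
    (\<Sum>e\<in>UNIV. (\<Sum>m\<in>M. \<Sum>n\<in>M. y e m * y e n / \<alpha> e * (\<integral>\<theta>. \<pi> \<theta> m * \<pi> \<theta> n \<partial>P))
      + (\<Sum>m\<in>M. y e m * (\<integral>\<theta>. \<theta> $ e * \<pi> \<theta> m \<partial>P)))"
proof -
  have int: "integrable P (\<lambda>\<theta>. \<pi> \<theta> m * \<pi> \<theta> n)" "integrable P (\<lambda>\<theta>. \<theta> $ e * \<pi> \<theta> m)"
    if "m \<in> M" "n \<in> M" for m n e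
    using that by (auto intro!: integrable_mult_message[OF \<pi>] integrable_message[OF \<pi>] integrable_state)
  have "total_delay (affine_delay \<alpha>) \<theta> (induced_flow M \<pi> y \<theta>) =
      (\<Sum>e\<in>UNIV. (\<Sum>m\<in>M. \<Sum>n\<in>M. y e m * y e n / \<alpha> e * (\<pi> \<theta> m * \<pi> \<theta> n))
      + (\<Sum>m\<in>M. y e m * (\<theta> $ e * \<pi> \<theta> m)))" for \<theta>
    unfolding total_delay_def affine_delay_def induced_flow_def
    unfolding vec_lambda_beta distrib_left times_divide_eq_right sum_product sum_divide_distrib
      sum_distrib_right
    by (intro sum.cong refl arg_cong2[where f = "(+)"]) (simp_all add: mult_ac sum_distrib_left)
  then show ?thesis
    unfolding flow_cost_def using int by (simp add: Bochner_Integration.integral_sum)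
qed

text \<open>An equilibrium minimizes the Beckmann potential, which for affine delays is the cost of the
  network with \<open>2 * \<alpha>\<close> in place of \<open>\<alpha>\<close>.\<close>

lemma exists_BWE:
  fixes M :: "'m set"
  assumes \<pi>: "signaling_rule M \<pi>"
  shows "\<exists>f. is_BWE (affine_delay \<alpha>) P M \<pi> f"
proof -
  define C where "C y = flow_cost (affine_delay (\<lambda>e. 2 * \<alpha> e)) P (induced_flow M \<pi> y)" for y
  \<comment> \<open>Responses are encoded as total functions on messages, fixed at 0 outside
    \<open>M\<close>. Every factor of the product is then compact, and so is \<open>F\<close> by
    Tychonoff.\<close>
  define F :: "('m \<Rightarrow> real ^ 'e) set"
    where "F = PiE UNIV (\<lambda>m. if m \<in> M then flows else {0})"
  have F_iff: "Z \<in> F \<longleftrightarrow> (\<forall>m\<in>M. Z m \<in> flows) \<and> (\<forall>m. m \<notin> M \<longrightarrow> Z m = 0)" for Z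
    unfolding F_def PiE_UNIV_domain by (auto split: if_splits)
  have "compactin (product_topology (\<lambda>_. euclidean) UNIV) F"
    unfolding F_def by (subst compactin_PiE) (auto simp: compact_flows)
  then have "compact F"
    by (simp add: euclidean_product_topology)
  moreover have "(\<lambda>m. if m \<in> M then axis undefined 1 else 0) \<in> F"
    by (simp add: F_iff axis_in_flows)
  moreover have "continuous_on F (\<lambda>Y. C (\<lambda>e m. Y m $ e))"
  proof -
    have "continuous_on F (\<lambda>Y. Y m $ e)" for m e
      by (intro continuous_on_component continuous_on_subset[OF continuous_on_product_coordinates]) auto
    then show ?thesis
      unfolding C_def flow_cost_induced_flow[OF \<pi>]
      unfolding divide_inverse
      by (intro continuous_on_sum continuous_on_add continuous_on_mult continuous_on_const)
  qed
  ultimately obtain Y where Y: "Y \<in> F"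
    and min: "\<And>Z. Z \<in> F \<Longrightarrow> C (\<lambda>e m. Y m $ e) \<le> C (\<lambda>e m. Z m $ e)"
    using continuous_attains_inf by (metis empty_iff)
  define y where "y = (\<lambda>e m. Y m $ e)"
  define f where "f = induced_flow M \<pi> y"
  have response_F: "response M (\<lambda>e m. Z m $ e)" if "Z \<in> F" for Z
    using that by (simp add: response_iff F_iff)
  have resp: "response M y"
    using response_F[OF Y] by (simp add: y_def)
  have adm: "admissible f"
    unfolding f_def by (rule admissible_induced_flow[OF \<pi> resp])
  have "message_delay \<alpha> \<pi> f m \<bullet> (\<chi> e. y e m) \<le> message_delay \<alpha> \<pi> f m \<bullet> v"
    if m: "m \<in> M" and v: "v \<in> flows" for m v
  proof -
    define d where "d = v - Y m"
    \<comment> \<open>\<open>L\<close> and \<open>Q\<close> are the integrands of the first- and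
      second-order terms when the response to message \<open>m\<close> alone moves in direction
      \<open>d\<close>.\<close>
    define L where "L \<theta> = (\<Sum>e\<in>UNIV. d $ e * (affine_delay \<alpha> e (\<theta> $ e) (f \<theta> $ e) * \<pi> \<theta> m))" for \<theta>
    define Q where "Q \<theta> = (\<Sum>e\<in>UNIV. (d $ e)\<^sup>2 / (2 * \<alpha> e)) * (\<pi> \<theta> m * \<pi> \<theta> m)" for \<theta>
    have int: "integrable P L" "integrable P Q"
      unfolding L_def Q_def
      by (intro Bochner_Integration.integrable_sum integrable_mult_right integrable_delay[OF adm]
          integrable_mult_message[OF \<pi> m] integrable_message[OF \<pi> m])+
    have "(\<integral>\<theta>. L \<theta> \<partial>P) = message_delay \<alpha> \<pi> f m \<bullet> d"
      unfolding L_def message_delay_def inner_vec_def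
      using integrable_mult_message[OF \<pi> m integrable_delay[OF adm]]
      by (simp add: Bochner_Integration.integral_sum mult.commute)
    moreover have "0 \<le> (\<integral>\<theta>. L \<theta> \<partial>P)"
    proof (rule linear_part_nonneg)
      fix t :: real assume t: "0 < t" "t \<le> 1"
      define Z where "Z = Y(m := Y m + t *\<^sub>R d)"
      have "Y m \<in> flows"
        using Y m by (simp add: F_iff)
      then have "(1 - t) *\<^sub>R Y m + t *\<^sub>R v \<in> flows"
        using t v convex_flows by (intro convexD) auto
      moreover have "(1 - t) *\<^sub>R Y m + t *\<^sub>R v = Y m + t *\<^sub>R d"
        by (simp add: d_def algebra_simps)
      ultimately have Z: "Z \<in> F"
        using Y m by (auto simp: F_iff Z_def)
      have "induced_flow M \<pi> (\<lambda>e m. Z m $ e) \<theta> = f \<theta> + (t * \<pi> \<theta> m) *\<^sub>R d" for \<theta>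
      proof -
        have "(\<Sum>n\<in>M. Z n $ e * \<pi> \<theta> n)
            = (\<Sum>n\<in>M. Y n $ e * \<pi> \<theta> n + (if n = m then t * \<pi> \<theta> m * d $ e else 0))" for e
          by (intro sum.cong) (auto simp: Z_def algebra_simps)
        then show ?thesis
          using m signaling_rule_finite[OF \<pi>]
          by (simp add: induced_flow_def f_def y_def vec_eq_iff sum.distrib)
      qed
      \<comment> \<open>With \<open>2 * \<alpha>\<close> the marginal cost
        \<open>2 * x / (2 * \<alpha> e) + \<theta> $ e\<close> is the actual delay under
        \<open>\<alpha>\<close>, so the linear term is the weighted delay in
        \<open>L\<close>.\<close>
      then have "total_delay (affine_delay (\<lambda>e. 2 * \<alpha> e)) \<theta> (induced_flow M \<pi> (\<lambda>e m. Z m $ e) \<theta>)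
          = total_delay (affine_delay (\<lambda>e. 2 * \<alpha> e)) \<theta> (f \<theta>) + (t * L \<theta> + t\<^sup>2 * Q \<theta>)" for \<theta>
        by (simp add: total_delay_add L_def Q_def inner_vec_def affine_delay_def sum_distrib_left
            sum_distrib_right power2_eq_square mult_ac)
      then have "C (\<lambda>e m. Z m $ e)
          = C y + (t * (\<integral>\<theta>. L \<theta> \<partial>P) + t\<^sup>2 * (\<integral>\<theta>. Q \<theta> \<partial>P))"
        using integrable_total_delay[OF adm adm] int
        by (simp add: C_def flow_cost_def f_def[symmetric] total_delay_def[symmetric])
      with min[OF Z] show "0 \<le> t * (\<integral>\<theta>. L \<theta> \<partial>P) + t\<^sup>2 * (\<integral>\<theta>. Q \<theta> \<partial>P)"
        by (simp add: y_def)
    qed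
    ultimately show ?thesis
      by (simp add: d_def y_def inner_diff_right)
  qed
  then show ?thesis
    unfolding is_BWE_iff_variational[OF \<pi>] using resp f_def by blast
qed

lemma is_BWE_BWE_flow:
  "signaling_rule M \<pi> \<Longrightarrow> is_BWE (affine_delay \<alpha>) P M \<pi> (BWE_flow (affine_delay \<alpha>) P M \<pi>)"
  unfolding BWE_flow_def by (rule someI_ex[OF exists_BWE])

end

text \<open>By second countability, the points outside the support are covered by countably many
  basic open sets of measure zero. Interiority, assumed on the support, thus holds almost
  everywhere.\<close>

lemma AE_law_support:
  assumes sets_P: "sets P = sets orthant_borel"
  shows "AE \<theta> in P. \<theta> \<in> law_support P"
proof -
  obtain B :: "(real ^ 'a) set set" where B: "countable B" "topological_basis B"
    using ex_countable_basis by blast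
  have sets: "U \<inter> space P \<in> sets P" if "open U" for U
    using that sets_eq_imp_space_eq[OF sets_P]
    by (auto simp: sets_P orthant_borel_def sets_restrict_space space_restrict_space Int_commute)
  define N where "N = {b \<in> B. emeasure P (b \<inter> space P) = 0}"
  have "AE \<theta> in P. \<theta> \<notin> b" if "b \<in> N" for b
  proof (rule AE_I')
    show "b \<inter> space P \<in> null_sets P"
      using that B sets topological_basis_open by (auto simp: N_def)
  qed auto
  moreover have "countable N"
    using B(1) by (simp add: N_def)
  ultimately have "AE \<theta> in P. \<forall>b\<in>N. \<theta> \<notin> b"
    by (simp add: AE_ball_countable)
  then show ?thesis
  proof (rule AE_mp, intro AE_I2 impI)
    fix \<theta> assume \<theta>: "\<theta> \<in> space P" "\<forall>b\<in>N. \<theta> \<notin> b"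
    have "0 < emeasure P (U \<inter> space P)" if U: "open U" "\<theta> \<in> U" for U
    proof -
      obtain b where b: "b \<in> B" "\<theta> \<in> b" "b \<subseteq> U"
        using topological_basisE[OF B(2) U] by blast
      then have "0 < emeasure P (b \<inter> space P)"
        using \<theta>(2) by (auto simp: N_def zero_less_iff_neq_zero)
      also have "\<dots> \<le> emeasure P (U \<inter> space P)"
        using b U sets by (intro emeasure_mono) auto
      finally show ?thesis .
    qed
    with \<theta>(1) show "\<theta> \<in> law_support P"
      by (simp add: law_support_def)
  qed
qed

section \<open>Recommending the system optimum\<close>

text \<open>The response given by the identity matrix is obedience to every recommendation.\<close>

lemma induced_flow_direct_rule:
  "induced_flow UNIV (direct_rule f) (\<lambda>e m. if e = m then 1 else 0) = f"
  by (auto simp: induced_flow_def direct_rule_def fun_eq_iff vec_eq_iff if_distrib[of "\<lambda>x. x * _"]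
      cong: if_cong)

locale affine_network = affine_delays \<alpha> + network_state P
  for \<alpha> :: "'e::finite \<Rightarrow> real" and P :: "(real ^ 'e) measure"
begin

abbreviation opt :: "real ^ 'e \<Rightarrow> real ^ 'e" where
  "opt \<equiv> system_optimum (affine_delay \<alpha>)"

lemma signaling_rule_direct_opt: "signaling_rule UNIV (direct_rule opt)"
proof -
  have "(\<lambda>\<theta>. opt \<theta> $ e) \<in> borel_measurable orthant_borel" for e
    unfolding orthant_borel_def
    by (intro borel_measurable_continuous_on_restrict continuous_on_component
        continuous_on_system_optimum)
  then show ?thesis
    by (simp add: signaling_rule_def direct_rule_def flows_nonneg flows_sum system_optimum_in_flows)
qed

lemma admissible_opt: "admissible opt"
  using admissible_induced_flow[OF signaling_rule_direct_opt, of "\<lambda>e m. if e = m then 1 else 0"]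
  by (simp add: induced_flow_direct_rule response_def)

lemma flow_cost_opt_le:
  assumes "admissible f"
  shows "flow_cost (affine_delay \<alpha>) P opt \<le> flow_cost (affine_delay \<alpha>) P f"
  using integrable_total_delay[OF assms assms] integrable_total_delay[OF admissible_opt admissible_opt]
    assms system_optimum_le
  unfolding flow_cost_def
  by (intro integral_mono) (auto simp: total_delay_def[abs_def] space_P admissible_def)

text \<open>By uniqueness, the equilibrium chosen by \<open>BWE_flow\<close> agrees almost
  everywhere with any given one.\<close>

lemma rule_cost_eq:
  assumes \<pi>: "signaling_rule M \<pi>" and f: "is_BWE (affine_delay \<alpha>) P M \<pi> f"
  shows "rule_cost (affine_delay \<alpha>) P M \<pi> = flow_cost (affine_delay \<alpha>) P f"
proof -
  note g = is_BWE_BWE_flow[OF \<pi>, of \<alpha>]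
  note adm = BWE_admissible[OF \<pi> f] BWE_admissible[OF \<pi> g]
  have "AE \<theta> in P. BWE_flow (affine_delay \<alpha>) P M \<pi> \<theta> = f \<theta>"
    using \<alpha>_pos by (rule BWE_unique[OF _ \<pi> g f])
  then show ?thesis
    unfolding rule_cost_def flow_cost_def total_delay_def
    by (intro integral_cong_AE borel_measurable_integrable integrable_total_delay adm)
      (auto elim: eventually_mono)
qed

lemma rule_cost_ge:
  "signaling_rule M \<pi> \<Longrightarrow>
    flow_cost (affine_delay \<alpha>) P opt \<le> rule_cost (affine_delay \<alpha>) P M \<pi>"
  unfolding rule_cost_def by (metis flow_cost_opt_le BWE_admissible is_BWE_BWE_flow)

lemma is_BWE_opt:
  assumes interior: "\<And>\<theta> e. \<theta> \<in> law_support P \<Longrightarrow> 0 < opt \<theta> $ e"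
    and int: "\<And>i j. integrable P (\<lambda>\<theta>. \<theta> $ i * \<theta> $ j)"
    and mean: "\<And>i. (\<integral>\<theta>. \<theta> $ i \<partial>P) = \<mu>"
    and cov: "\<And>i j. i \<noteq> j \<Longrightarrow> (\<integral>\<theta>. \<theta> $ i * \<theta> $ j \<partial>P) = \<mu> * \<mu>"
  shows "is_BWE (affine_delay \<alpha>) P UNIV (direct_rule opt) opt"
proof -
  define A where "A = (\<Sum>k\<in>UNIV. \<alpha> k)"
  define V where "V i = (\<integral>\<theta>. \<theta> $ i * \<theta> $ i \<partial>P) - \<mu> * \<mu>" for i
  have A: "\<alpha> e \<le> A" for e
    unfolding A_def using \<alpha>_pos by (intro member_le_sum) (auto intro: less_imp_le)
  then have A_pos: "0 < A"
    using \<alpha>_pos less_le_trans by blast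
  have V: "0 \<le> V i" for i
  proof -
    have "0 \<le> variance (\<lambda>\<theta>. \<theta> $ i)"
      by (rule variance_positive)
    also have "\<dots> = V i"
      using int[of i i]
      by (subst variance_eq) (simp_all add: integrable_state V_def power2_eq_square mean)
    finally show ?thesis .
  qed
  have "(\<integral>\<theta>. (affine_delay \<alpha> i (\<theta> $ i) (opt \<theta> $ i) - affine_delay \<alpha> j (\<theta> $ j) (opt \<theta> $ j))
      * opt \<theta> $ i \<partial>P) \<le> 0" (is "(\<integral>\<theta>. ?I \<theta> \<partial>P) \<le> 0") if ij: "i \<noteq> j" for i j
  proof -
    define D where "D \<theta> = \<theta> $ i - \<theta> $ j" for \<theta> :: "real ^ 'e"
    \<comment> \<open>\<open>J\<close> is the obedience integrand after substituting the interior
      formula and expanding the multiplier, so that only the moments of \<open>D\<close> and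
      \<open>D * \<theta>_k\<close> remain to be computed.\<close>
    define J where "J \<theta> = \<alpha> i / 4 * (2 / A * D \<theta> + (\<Sum>k\<in>UNIV. \<alpha> k / A * (D \<theta> * \<theta> $ k)) - D \<theta> * \<theta> $ i)" for \<theta>
    have int_D: "integrable P D" "integrable P (\<lambda>\<theta>. D \<theta> * \<theta> $ k)" for k
      unfolding D_def by (auto simp: left_diff_distrib integrable_state int)
    have E_D: "(\<integral>\<theta>. D \<theta> \<partial>P) = 0"
      by (simp add: D_def integrable_state mean)
    \<comment> \<open>Equal means make the \<open>\<mu> * \<mu>\<close> terms cancel, and the zero
      covariances leave only the variances of \<open>i\<close> and \<open>j\<close>.\<close>
    have E_Dk: "(\<integral>\<theta>. D \<theta> * \<theta> $ k \<partial>P) = (if k = i then V i else 0) - (if k = j then V j else 0)" for k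
      using ij by (auto simp: D_def left_diff_distrib int cov V_def)
    have "AE \<theta> in P. ?I \<theta> = J \<theta>"
      using AE_law_support[OF sets_P]
    proof (rule eventually_mono)
      fix \<theta> assume "\<theta> \<in> law_support P"
      then have pos: "0 < opt \<theta> $ e" for e
        using interior by simp
      define l where "l = (2 + (\<Sum>k\<in>UNIV. \<alpha> k * \<theta> $ k)) / A"
      have x: "opt \<theta> $ e = \<alpha> e / 2 * (l - \<theta> $ e)" for e
        using system_optimum_interior[OF pos] by (simp add: l_def A_def)
      have delay: "affine_delay \<alpha> e (\<theta> $ e) (opt \<theta> $ e) = (l + \<theta> $ e) / 2" for e
        using \<alpha>_pos[of e] unfolding x affine_delay_def by (simp add: field_simps)
      \<comment> \<open>The multiplier cancels in the difference of delays, which is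
        \<open>D \<theta> / 2\<close>; it survives only in the factor
        \<open>opt \<theta> $ i\<close>.\<close>
      have "?I \<theta> = \<alpha> i / 4 * (D \<theta> * l - D \<theta> * \<theta> $ i)"
        unfolding delay D_def unfolding x by (simp add: field_simps)
      also have "D \<theta> * l = 2 / A * D \<theta> + (\<Sum>k\<in>UNIV. \<alpha> k / A * (D \<theta> * \<theta> $ k))"
        by (simp add: l_def add_divide_distrib distrib_left sum_divide_distrib sum_distrib_left mult_ac)
      finally show "?I \<theta> = J \<theta>"
        by (simp add: J_def)
    qed
    moreover have "integrable P ?I"
      by (intro integrable_mult_flow admissible_opt Bochner_Integration.integrable_diff integrable_delay)
    moreover have "integrable P J"
      unfolding J_def using int_D by simp
    ultimately have "(\<integral>\<theta>. ?I \<theta> \<partial>P) = (\<integral>\<theta>. J \<theta> \<partial>P)"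
      by (intro integral_cong_AE) auto
    also have "\<dots> = \<alpha> i / 4 * ((\<Sum>k\<in>UNIV. \<alpha> k / A * (\<integral>\<theta>. D \<theta> * \<theta> $ k \<partial>P)) - (\<integral>\<theta>. D \<theta> * \<theta> $ i \<partial>P))"
      unfolding J_def using int_D E_D by (simp add: Bochner_Integration.integral_sum)
    also have "\<dots> = \<alpha> i / 4 * (\<alpha> i / A * V i - \<alpha> j / A * V j - V i)"
      unfolding E_Dk using ij
      by (simp add: right_diff_distrib sum_subtractf if_distrib[of "\<lambda>x. _ * x"] cong: if_cong)
    also have "\<dots> \<le> 0"
    proof (rule mult_nonneg_nonpos)
      \<comment> \<open>The share \<open>\<alpha> i / A\<close> is at most 1, so
        \<open>- V i\<close> absorbs the positive term.\<close>
      have "\<alpha> i / A * V i \<le> 1 * V i"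
        using A A_pos V by (intro mult_right_mono) auto
      moreover have "0 \<le> \<alpha> j / A * V j"
        by (intro mult_nonneg_nonneg divide_nonneg_pos less_imp_le[OF \<alpha>_pos] A_pos V)
      ultimately show "\<alpha> i / A * V i - \<alpha> j / A * V j - V i \<le> 0"
        by linarith
    qed (use \<alpha>_pos[of i] in simp)
    finally show ?thesis .
  qed
  then have "(\<integral>\<theta>. (affine_delay \<alpha> i (\<theta> $ i) (opt \<theta> $ i) - affine_delay \<alpha> j (\<theta> $ j) (opt \<theta> $ j))
      * opt \<theta> $ i \<partial>P) \<le> 0" for i j
    by (cases "i = j") simp_all
  then show ?thesis
    unfolding is_BWE_def
    by (intro exI[of _ "\<lambda>e m. if e = m then 1 else 0"])
      (simp add: induced_flow_direct_rule response_def direct_rule_def split: if_splits)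
qed

end

theorem corollary4:
  fixes \<Omega> :: "'w measure"
    and \<Theta> :: "'w \<Rightarrow> real ^ 'e::finite"
    and P :: "(real ^ 'e) measure"
    and \<tau> :: "'e \<Rightarrow> real \<Rightarrow> real \<Rightarrow> real"
    and \<alpha> :: "'e \<Rightarrow> real"
    and \<Delta> K :: "'e \<Rightarrow> 'e \<Rightarrow> real"
  assumes "prob_space \<Omega>"
    and "\<Theta> \<in> measurable \<Omega> orthant_borel"
    and "P = distr \<Omega> orthant_borel \<Theta>"
    and "\<And>e. integrable \<Omega> (\<lambda>\<omega>. \<Theta> \<omega> $ e)"
    and "\<And>e. integrable \<Omega> (\<lambda>\<omega>. (\<Theta> \<omega> $ e)\<^sup>2)"
    and "\<And>e. \<alpha> e > 0"
    and "\<And>e t x. \<tau> e t x = x / \<alpha> e + t"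
    and "\<And>\<theta> e. \<theta> \<in> law_support P \<Longrightarrow> system_optimum \<tau> \<theta> $ e > 0"
    and "\<And>i j. \<Delta> i j = (\<integral>\<omega>. \<Theta> \<omega> $ i - \<Theta> \<omega> $ j \<partial>\<Omega>)"
    and "\<And>i j. K i j = (\<integral>\<omega>. \<Theta> \<omega> $ i * \<Theta> \<omega> $ j \<partial>\<Omega>)
                       - (\<integral>\<omega>. \<Theta> \<omega> $ i \<partial>\<Omega>) * (\<integral>\<omega>. \<Theta> \<omega> $ j \<partial>\<Omega>)"
    and "\<And>i j. \<Delta> i j = 0"
    and "\<And>i j. i \<noteq> j \<Longrightarrow> K i j = 0"
  shows "optimal_rule TYPE('n) \<tau> P UNIV (direct_rule (system_optimum \<tau>)) \<and>
         rule_cost \<tau> P UNIV (direct_rule (system_optimum \<tau>)) = flow_cost \<tau> P (system_optimum \<tau>)"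
proof -
  note \<Theta> = assms(2)
  have \<tau>: "\<tau> = affine_delay \<alpha>"
    by (simp add: assms(7) affine_delay_def fun_eq_iff)
  have comp: "(\<lambda>\<theta>. \<theta> $ e) \<in> borel_measurable orthant_borel" for e :: 'e
    unfolding orthant_borel_def by (intro measurable_restrict_space1) measurable
  interpret prob_space P
    unfolding assms(3) by (rule prob_space.prob_space_distr[OF assms(1) \<Theta>])
  interpret affine_network \<alpha> P
  proof
    show "integrable P (\<lambda>\<theta>. \<theta> $ e)" for e
      unfolding assms(3) using assms(4) by (simp add: integrable_distr_eq[OF \<Theta> comp])
  qed (use assms(3,6) in auto)
  have "integrable \<Omega> (\<lambda>\<omega>. \<Theta> \<omega> $ i * \<Theta> \<omega> $ j)" for i j
  proof (rule Bochner_Integration.integrable_bound)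
    show "integrable \<Omega> (\<lambda>\<omega>. (\<Theta> \<omega> $ i)\<^sup>2 + (\<Theta> \<omega> $ j)\<^sup>2)"
      using assms(5) by simp
    show "(\<lambda>\<omega>. \<Theta> \<omega> $ i * \<Theta> \<omega> $ j) \<in> borel_measurable \<Omega>"
      using assms(4) by (intro borel_measurable_times borel_measurable_integrable)
    \<comment> \<open>Square-integrability of the single states thus yields integrability of their
      products.\<close>
    have "\<bar>a * b\<bar> \<le> a\<^sup>2 + b\<^sup>2" for a b :: real
      using sum_squares_bound[of "\<bar>a\<bar>" "\<bar>b\<bar>"] mult_nonneg_nonneg[OF abs_ge_zero abs_ge_zero, of a b]
      unfolding abs_mult power2_abs by linarith
    then show "AE \<omega> in \<Omega>. norm (\<Theta> \<omega> $ i * \<Theta> \<omega> $ j) \<le> norm ((\<Theta> \<omega> $ i)\<^sup>2 + (\<Theta> \<omega> $ j)\<^sup>2)"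
      by simp
  qed
  then have int: "integrable P (\<lambda>\<theta>. \<theta> $ i * \<theta> $ j)" for i j
    unfolding assms(3)
    by (simp add: integrable_distr_eq[OF \<Theta> borel_measurable_times[OF comp comp]])
  have E: "(\<integral>\<theta>. \<theta> $ i \<partial>P) = (\<integral>\<omega>. \<Theta> \<omega> $ i \<partial>\<Omega>)" for i
    unfolding assms(3) by (rule integral_distr[OF \<Theta> comp])
  have EE: "(\<integral>\<theta>. \<theta> $ i * \<theta> $ j \<partial>P) = (\<integral>\<omega>. \<Theta> \<omega> $ i * \<Theta> \<omega> $ j \<partial>\<Omega>)" for i j
    unfolding assms(3) by (rule integral_distr[OF \<Theta> borel_measurable_times[OF comp comp]])
  \<comment> \<open>\<open>undefined\<close> stands for an arbitrary link:
    \<open>\<Delta> = 0\<close> makes all means equal.\<close>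
  define \<mu> where "\<mu> = (\<integral>\<theta>. \<theta> $ undefined \<partial>P)"
  have mean: "(\<integral>\<theta>. \<theta> $ i \<partial>P) = \<mu>" for i
    using assms(9)[of i undefined] assms(11) assms(4) by (simp add: E \<mu>_def)
  have cov: "(\<integral>\<theta>. \<theta> $ i * \<theta> $ j \<partial>P) = \<mu> * \<mu>" if "i \<noteq> j" for i j
    using assms(10)[of i j] assms(12)[OF that] mean by (simp add: E EE)
  have "is_BWE (affine_delay \<alpha>) P UNIV (direct_rule opt) opt"
    using assms(8) int mean cov unfolding \<tau> by (rule is_BWE_opt)
  then have "rule_cost (affine_delay \<alpha>) P UNIV (direct_rule opt) = flow_cost (affine_delay \<alpha>) P opt"
    by (rule rule_cost_eq[OF signaling_rule_direct_opt])
  then show ?thesis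
    unfolding \<tau> optimal_rule_def by (simp add: signaling_rule_direct_opt rule_cost_ge)
qed

end
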